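(* Let $k,m$ be positive integers with $m\ge k$, and let $M\in\mathbb R^{k\times k}$ be a symmetric positive definite matrix with $\operatorname{tr}M=m$. Then there exist vectors $\mathbf a_1,\dots,\mathbf a_m\in\mathbb R^k$ with $\|\mathbf a_j\|=1$ for $j=1,\dots,m$ such that the matrix $A=(\mathbf a_1,\dots,\mathbf a_m)\in\mathbb R^{k\times m}$ with columns $\mathbf a_j$ satisfies $AA^t=M$.
   Context: $\|\cdot\|$ is the Euclidean norm on $\mathbb R^k$. *)

theory Defs
  imports "HOL-Analysis.Analysis"
begin

definition symmetric_positive_definite :: "real^'k^'k \<Rightarrow> bool" where
  "symmetric_positive_definite M \<longleftrightarrow>
     transpose M = M \<and> (\<forall>x. x \<noteq> 0 \<longrightarrow> x \<bullet> (M *v x) > 0)"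

text \<open>In \<open>real^'m^'k\<close> the outer index \<open>'k\<close> is the row index.\<close>

definition matrix_with_columns :: "('m \<Rightarrow> real^'k) \<Rightarrow> real^'m^'k" where
  "matrix_with_columns a = (\<chi> i j. a j $ i)"

end

theory Submission
  imports Defs
begin

text \<open>
  The identity \<open>A A\<^sup>t = M\<close> says that the columns of \<open>A\<close> have \<open>M\<close> as their frame operator
  \<open>x \<mapsto> \<Sum>\<^sub>j (a\<^sub>j \<bullet> x) a\<^sub>j\<close>. Two observations produce such unit vectors.

  A positive semidefinite operator on a space of dimension \<open>k\<close> is the frame operator of \<open>k\<close>
  vectors: Cholesky elimination subtracts an operator of rank at most one per basis vector, and what
  remains stays positive semidefinite (\<open>Cholesky_step\<close>, \<open>psd_is_frame_operator\<close>). Since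
  \<open>m \<ge> k\<close>, padding with zero vectors gives a family of \<open>m\<close> vectors. Their lengths are
  arbitrary, but their squared lengths add up to \<open>tr M = m\<close>.

  Replacing two members \<open>u, v\<close> of a family by \<open>cos t u + sin t v\<close> and
  \<open>- sin t u + cos t v\<close> leaves the frame operator unchanged, and as \<open>t\<close> runs from \<open>0\<close> to
  \<open>\<pi>/2\<close> the length of the first one moves continuously from \<open>\<parallel>u\<parallel>\<close> to \<open>\<parallel>v\<parallel>\<close>.
  As long as some vector is not a unit vector, the average squared length being \<open>1\<close> forces one
  vector to be shorter and another to be longer than \<open>1\<close>; a rotation of these two creates a new
  unit vector and touches no vector that is already one (\<open>unit_norm_rearrangement\<close>).
\<close>

section \<open>Positive semidefinite operators as frame operators\<close>

text \<open>
  If \<open>x \<bullet> f x = 0\<close> but \<open>f x \<noteq> 0\<close>, the quadratic form would be negative at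
  \<open>x + t f x\<close> for small \<open>t < 0\<close>, because the term linear in \<open>t\<close> dominates.
\<close>

lemma psd_isotropic_imp_kernel:
  fixes f :: "'a::real_inner \<Rightarrow> 'a"
  assumes lin: "linear f"
    and adj: "\<And>x y. x \<bullet> f y = f x \<bullet> y"
    and psd: "\<And>x. 0 \<le> x \<bullet> f x"
    and iso: "x \<bullet> f x = 0"
  shows "f x = 0"
proof (rule ccontr)
  assume "f x \<noteq> 0"
  define N where "N = f x \<bullet> f x"
  define q where "q = f x \<bullet> f (f x)"
  \<comment> \<open>Adding 1 to \<open>q\<close> keeps the denominator positive; for \<open>q > 0\<close> the minimiser is \<open>- N / q\<close>.\<close>
  define t where "t = - N / (q + 1)"
  have "N > 0"
    using \<open>f x \<noteq> 0\<close> by (simp add: N_def)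
  have "q \<ge> 0"
    using psd by (simp add: q_def)
  have "(x + t *\<^sub>R f x) \<bullet> f (x + t *\<^sub>R f x) = 2 * t * N + t\<^sup>2 * q"
    using iso adj[of x "f x"]
    by (simp add: linear_add[OF lin] linear_cmul[OF lin] inner_add_left inner_add_right
        N_def q_def power2_eq_square algebra_simps)
  also have "\<dots> = - (t\<^sup>2 * (q + 2))"
  proof -
    have "N = - t * (q + 1)"
      using \<open>q \<ge> 0\<close> by (simp add: t_def)
    then show ?thesis
      by algebra
  qed
  also have "\<dots> < 0"
    using \<open>N > 0\<close> \<open>q \<ge> 0\<close> by (simp add: t_def)
  finally show False
    using psd[of "x + t *\<^sub>R f x"] by simp
qed

text \<open>
  Completing the square: with \<open>v = f b / sqrt (b \<bullet> f b)\<close>, the deflated form at \<open>x\<close> equals the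
  original form at \<open>x - c b\<close>, where \<open>c\<close> minimises it over the line through \<open>x\<close> in
  direction \<open>b\<close>; hence it is still nonnegative. The last conclusion says that kernel vectors found
  in earlier steps survive.
\<close>

lemma Cholesky_step:
  fixes f :: "'a::real_inner \<Rightarrow> 'a"
  assumes lin: "linear f"
    and adj: "\<And>x y. x \<bullet> f y = f x \<bullet> y"
    and psd: "\<And>x. 0 \<le> x \<bullet> f x"
  obtains v where
    "\<And>x. 0 \<le> x \<bullet> (f x - (v \<bullet> x) *\<^sub>R v)"
    "f b - (v \<bullet> b) *\<^sub>R v = 0"
    "\<And>c. f c = 0 \<Longrightarrow> v \<bullet> c = 0"
proof (cases "b \<bullet> f b = 0")
  case True
  then have "f b = 0"
    using psd_isotropic_imp_kernel[OF lin adj psd] by simp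
  then show ?thesis
    using that[of 0] psd by simp
next
  case False
  define d where "d = b \<bullet> f b"
  have "d > 0"
    using False psd[of b] by (simp add: d_def)
  define v where "v = f b /\<^sub>R sqrt d"
  have rank_one: "(v \<bullet> x) *\<^sub>R v = ((f b \<bullet> x) / d) *\<^sub>R f b" for x
    using \<open>d > 0\<close> by (simp add: v_def field_simps)
  show ?thesis
  proof (rule that[of v])
    fix x
    define c where "c = (f b \<bullet> x) / d"
    have "x \<bullet> f b = c * d" "b \<bullet> f x = c * d"
      using \<open>d > 0\<close> adj[of b x] by (simp_all add: c_def inner_commute)
    then have "(x - c *\<^sub>R b) \<bullet> f (x - c *\<^sub>R b) = x \<bullet> (f x - c *\<^sub>R f b)"
      by (simp add: linear_diff[OF lin] linear_cmul[OF lin] inner_diff_left inner_diff_right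
          d_def[symmetric])
    then show "0 \<le> x \<bullet> (f x - (v \<bullet> x) *\<^sub>R v)"
      using psd[of "x - c *\<^sub>R b"] rank_one[of x] by (simp add: c_def)
  next
    show "f b - (v \<bullet> b) *\<^sub>R v = 0"
      using \<open>d > 0\<close> by (simp only: rank_one) (simp add: d_def inner_commute)
  next
    fix c
    assume "f c = 0"
    then show "v \<bullet> c = 0"
      using adj[of b c] by (simp add: v_def)
  qed
qed

text \<open>
  The set \<open>J\<close> holds the basis vectors not yet eliminated; the induction removes them one at a time.
\<close>

lemma psd_is_frame_operator_on:
  fixes f :: "'a::euclidean_space \<Rightarrow> 'a"
  assumes "finite J" and "linear f"
    and "\<And>x y. x \<bullet> f y = f x \<bullet> y"
    and "\<And>x. 0 \<le> x \<bullet> f x"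
    and "\<And>b. b \<in> Basis - J \<Longrightarrow> f b = 0"
  shows "\<exists>a. \<forall>x. f x = (\<Sum>b\<in>J. (a b \<bullet> x) *\<^sub>R a b)"
  using assms
proof (induction J arbitrary: f rule: finite_induct)
  case empty
  then have "f x = 0" for x
    using linear_eq_stdbasis[of f "\<lambda>_. 0"] by (simp add: linear_zero)
  then show ?case
    by simp
next
  case (insert b J)
  obtain v where v: "\<And>x. 0 \<le> x \<bullet> (f x - (v \<bullet> x) *\<^sub>R v)"
    "f b - (v \<bullet> b) *\<^sub>R v = 0" "\<And>c. f c = 0 \<Longrightarrow> v \<bullet> c = 0"
    using Cholesky_step[OF insert.prems(1-3)] by metis
  define g where "g = (\<lambda>x. f x - (v \<bullet> x) *\<^sub>R v)"
  have "linear g"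
    by (rule linearI) (simp_all add: g_def linear_add[OF insert.prems(1)]
        linear_cmul[OF insert.prems(1)] inner_add_right algebra_simps)
  moreover have "x \<bullet> g y = g x \<bullet> y" for x y
    using insert.prems(2)[of x y]
    by (simp add: g_def inner_diff_left inner_diff_right inner_commute)
  moreover have "0 \<le> x \<bullet> g x" for x
    using v(1) by (simp add: g_def)
  moreover have "g c = 0" if "c \<in> Basis - J" for c
    using that v(2) v(3)[of c] insert.prems(4)[of c] by (cases "c = b") (auto simp: g_def)
  ultimately obtain a where a: "\<And>x. g x = (\<Sum>c\<in>J. (a c \<bullet> x) *\<^sub>R a c)"
    using insert.IH by blast
  have "f x = (\<Sum>c\<in>insert b J. ((a(b := v)) c \<bullet> x) *\<^sub>R (a(b := v)) c)" for x
  proof -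
    have "(\<Sum>c\<in>J. ((a(b := v)) c \<bullet> x) *\<^sub>R (a(b := v)) c) = g x"
      unfolding a using insert.hyps(2) by (intro sum.cong) auto
    then show ?thesis
      using insert.hyps by (simp add: g_def)
  qed
  then show ?case
    by blast
qed

text \<open>
  An index type with at least \<open>DIM('a)\<close> elements has room for the basis; the remaining indices
  carry the zero vector.
\<close>

lemma psd_is_frame_operator:
  fixes f :: "'a::euclidean_space \<Rightarrow> 'a"
  assumes "linear f"
    and "\<And>x y. x \<bullet> f y = f x \<bullet> y"
    and "\<And>x. 0 \<le> x \<bullet> f x"
    and card: "DIM('a) \<le> CARD('m::finite)"
  shows "\<exists>a :: 'm \<Rightarrow> 'a. \<forall>x. f x = (\<Sum>j\<in>UNIV. (a j \<bullet> x) *\<^sub>R a j)"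
proof -
  have "\<exists>a :: 'a \<Rightarrow> 'a. \<forall>x. f x = (\<Sum>b\<in>Basis. (a b \<bullet> x) *\<^sub>R a b)"
    by (rule psd_is_frame_operator_on[OF finite_Basis assms(1-3)]) simp
  then obtain a :: "'a \<Rightarrow> 'a" where a: "\<And>x. f x = (\<Sum>b\<in>Basis. (a b \<bullet> x) *\<^sub>R a b)"
    by blast
  obtain e :: "'a \<Rightarrow> 'm" where e: "inj_on e Basis"
    using card_le_inj[of "Basis :: 'a set" "UNIV :: 'm set"] card by auto
  define a' where "a' = (\<lambda>j. if j \<in> e ` Basis then a (inv_into Basis e j) else 0)"
  have "f x = (\<Sum>j\<in>UNIV. (a' j \<bullet> x) *\<^sub>R a' j)" for x
  proof -
    have "(\<Sum>j\<in>UNIV. (a' j \<bullet> x) *\<^sub>R a' j) = (\<Sum>j\<in>e ` Basis. (a' j \<bullet> x) *\<^sub>R a' j)"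
      by (rule sum.mono_neutral_right) (auto simp: a'_def)
    also have "\<dots> = (\<Sum>b\<in>Basis. (a b \<bullet> x) *\<^sub>R a b)"
      unfolding sum.reindex[OF e] by (rule sum.cong) (auto simp: a'_def e)
    finally show ?thesis
      by (simp add: a)
  qed
  then show ?thesis
    by blast
qed

section \<open>Equalising lengths by plane rotations\<close>

lemma rotation_to_unit_norm:
  fixes u v :: "'a::real_inner"
  assumes "norm u < 1" "1 < norm v"
  obtains t where "norm (cos t *\<^sub>R u + sin t *\<^sub>R v) = 1"
proof -
  have "\<exists>t\<ge>0. t \<le> pi/2 \<and> norm (cos t *\<^sub>R u + sin t *\<^sub>R v) = 1"
    by (rule IVT') (use assms in \<open>auto intro!: continuous_intros\<close>)
  then show ?thesis
    using that by blast
qed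

lemma rotation_preserves_rank_two_sum:
  fixes u v x :: "'a::real_inner" and t :: real
  defines "u' \<equiv> cos t *\<^sub>R u + sin t *\<^sub>R v"
    and "v' \<equiv> (- sin t) *\<^sub>R u + cos t *\<^sub>R v"
  shows "(u' \<bullet> x) *\<^sub>R u' + (v' \<bullet> x) *\<^sub>R v' = (u \<bullet> x) *\<^sub>R u + (v \<bullet> x) *\<^sub>R v"
    and "(norm u')\<^sup>2 + (norm v')\<^sup>2 = (norm u)\<^sup>2 + (norm v)\<^sup>2"
proof -
  define c where "c = cos t"
  define s where "s = sin t"
  have cs: "c * c + s * s = 1"
    using sin_cos_squared_add3[of t] by (simp add: c_def s_def)
  have "(u' \<bullet> x) *\<^sub>R u' + (v' \<bullet> x) *\<^sub>R v'
      = ((c * c + s * s) * (u \<bullet> x)) *\<^sub>R u + ((c * c + s * s) * (v \<bullet> x)) *\<^sub>R v"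
    unfolding u'_def v'_def c_def[symmetric] s_def[symmetric]
    by (simp add: inner_add_left algebra_simps)
  then show "(u' \<bullet> x) *\<^sub>R u' + (v' \<bullet> x) *\<^sub>R v' = (u \<bullet> x) *\<^sub>R u + (v \<bullet> x) *\<^sub>R v"
    by (simp add: cs)
  have "u' \<bullet> u' + v' \<bullet> v' = (c * c + s * s) * (u \<bullet> u) + (c * c + s * s) * (v \<bullet> v)"
    unfolding u'_def v'_def c_def[symmetric] s_def[symmetric]
    by (simp add: inner_add_left inner_add_right inner_commute[of v u] algebra_simps)
  then show "(norm u')\<^sup>2 + (norm v')\<^sup>2 = (norm u)\<^sup>2 + (norm v)\<^sup>2"
    by (simp add: cs power2_norm_eq_inner)
qed

lemma exists_short_and_long_vector:
  fixes a :: "'m::finite \<Rightarrow> 'a::real_inner"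
  assumes total: "(\<Sum>j\<in>UNIV. (norm (a j))\<^sup>2) = real CARD('m)"
    and non_unit: "\<exists>j. norm (a j) \<noteq> 1"
  obtains p q where "norm (a p) < 1" "1 < norm (a q)"
proof -
  have sum0: "(\<Sum>j\<in>UNIV. (norm (a j))\<^sup>2 - 1) = 0"
    using total by (simp add: sum_subtractf)
  obtain r where r: "norm (a r) \<noteq> 1"
    using non_unit by blast
  then have r2: "(norm (a r))\<^sup>2 - 1 \<noteq> 0"
    by (simp add: power2_eq_1_iff) (metis norm_ge_zero not_one_le_zero neg_0_le_iff_le order_trans)
  have "\<exists>p. norm (a p) < 1"
  proof (rule ccontr)
    assume "\<nexists>p. norm (a p) < 1"
    then have "\<forall>j\<in>UNIV. 0 \<le> (norm (a j))\<^sup>2 - 1"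
      by (simp add: not_less)
    then show False
      using sum0 r2 sum_nonneg_eq_0_iff[of UNIV "\<lambda>j. (norm (a j))\<^sup>2 - 1"] by auto
  qed
  moreover have "\<exists>q. 1 < norm (a q)"
  proof (rule ccontr)
    assume "\<nexists>q. 1 < norm (a q)"
    then have "\<forall>j\<in>UNIV. 0 \<le> 1 - (norm (a j))\<^sup>2"
      by (simp add: not_less power_le_one)
    moreover have "(\<Sum>j\<in>UNIV. 1 - (norm (a j))\<^sup>2) = 0"
      using total by (simp add: sum_subtractf)
    ultimately show False
      using r2 sum_nonneg_eq_0_iff[of UNIV "\<lambda>j. 1 - (norm (a j))\<^sup>2"] by auto
  qed
  ultimately show ?thesis
    using that by blast
qed

text \<open>
  Induction on the number of vectors of length other than \<open>1\<close>: one rotation of a short and a long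
  vector lowers it, while both the frame operator and the total squared length are kept.
\<close>

lemma unit_norm_rearrangement:
  fixes a :: "'m::finite \<Rightarrow> 'a::real_inner"
  assumes "(\<Sum>j\<in>UNIV. (norm (a j))\<^sup>2) = real CARD('m)"
  shows "\<exists>b :: 'm \<Rightarrow> 'a. (\<forall>j. norm (b j) = 1) \<and>
           (\<forall>x. (\<Sum>j\<in>UNIV. (b j \<bullet> x) *\<^sub>R b j) = (\<Sum>j\<in>UNIV. (a j \<bullet> x) *\<^sub>R a j))"
  using assms
proof (induction "card {j. norm (a j) \<noteq> 1}" arbitrary: a rule: less_induct)
  case less
  show ?case
  proof (cases "\<exists>j. norm (a j) \<noteq> 1")
    case False
    then show ?thesis
      by (intro exI[of _ a]) simp
  next
    case True
    obtain p q where pq: "norm (a p) < 1" "1 < norm (a q)"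
      using exists_short_and_long_vector[OF less.prems True] .
    then have "p \<noteq> q"
      by auto
    obtain t where t: "norm (cos t *\<^sub>R a p + sin t *\<^sub>R a q) = 1"
      using rotation_to_unit_norm[OF pq] .
    define a' where "a' = a(p := cos t *\<^sub>R a p + sin t *\<^sub>R a q,
                            q := (- sin t) *\<^sub>R a p + cos t *\<^sub>R a q)"
    have a'_simps: "a' p = cos t *\<^sub>R a p + sin t *\<^sub>R a q"
        "a' q = (- sin t) *\<^sub>R a p + cos t *\<^sub>R a q"
        "\<And>j. j \<in> UNIV - {p, q} \<Longrightarrow> a' j = a j"
      using \<open>p \<noteq> q\<close> by (auto simp: a'_def)
    have split: "(\<Sum>j\<in>UNIV. h j) = (\<Sum>j\<in>UNIV - {p, q}. h j) + (h p + h q)"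
      for h :: "'m \<Rightarrow> 'b::real_vector"
      using \<open>p \<noteq> q\<close> sum.subset_diff[of "{p, q}" UNIV h] by simp
    have frame: "(\<Sum>j\<in>UNIV. (a' j \<bullet> x) *\<^sub>R a' j) = (\<Sum>j\<in>UNIV. (a j \<bullet> x) *\<^sub>R a j)" for x
      unfolding split a'_simps(1,2) rotation_preserves_rank_two_sum(1)
      by (intro arg_cong2[where f = "(+)"] sum.cong refl) (simp add: a'_simps(3))
    have total: "(\<Sum>j\<in>UNIV. (norm (a' j))\<^sup>2) = real CARD('m)"
      unfolding less.prems[symmetric] split a'_simps(1,2) rotation_preserves_rank_two_sum(2)
      by (intro arg_cong2[where f = "(+)"] sum.cong refl) (simp add: a'_simps(3))
    have "{j. norm (a' j) \<noteq> 1} \<subseteq> {j. norm (a j) \<noteq> 1} - {p}"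
      using t pq \<open>p \<noteq> q\<close> by (auto simp: a'_def)
    moreover have "p \<in> {j. norm (a j) \<noteq> 1}"
      using pq by simp
    ultimately have "card {j. norm (a' j) \<noteq> 1} < card {j. norm (a j) \<noteq> 1}"
      by (intro psubset_card_mono) auto
    from less.hyps[OF this total] show ?thesis
      unfolding frame .
  qed
qed

section \<open>Translation to matrices\<close>

lemma frame_operator_of_columns:
  fixes a :: "'m::finite \<Rightarrow> real^'k::finite"
  shows "(matrix_with_columns a ** transpose (matrix_with_columns a)) *v x
       = (\<Sum>j\<in>UNIV. (a j \<bullet> x) *\<^sub>R a j)"
proof -
  have "transpose (matrix_with_columns a) *v x = (\<chi> j. a j \<bullet> x)"
    by (simp add: vec_eq_iff matrix_vector_mult_def transpose_def matrix_with_columns_def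
        inner_vec_def)
  then show ?thesis
    unfolding matrix_vector_mul_assoc[symmetric]
    by (simp add: vec_eq_iff matrix_vector_mult_def matrix_with_columns_def mult.commute)
qed

lemma trace_of_columns:
  fixes a :: "'m::finite \<Rightarrow> real^'k::finite"
  shows "trace (matrix_with_columns a ** transpose (matrix_with_columns a))
       = (\<Sum>j\<in>UNIV. (norm (a j))\<^sup>2)"
proof -
  have "trace (matrix_with_columns a ** transpose (matrix_with_columns a))
      = (\<Sum>i\<in>UNIV. \<Sum>j\<in>UNIV. a j $ i * a j $ i)"
    by (simp add: trace_def matrix_matrix_mult_def transpose_def matrix_with_columns_def)
  also have "\<dots> = (\<Sum>j\<in>UNIV. \<Sum>i\<in>UNIV. a j $ i * a j $ i)"
    by (rule sum.swap)
  finally show ?thesis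
    by (simp add: power2_norm_eq_inner inner_vec_def)
qed

theorem lemma5p6:
  fixes M :: "real^'k::finite^'k::finite"
  assumes "CARD('m::finite) \<ge> CARD('k)"
    and "symmetric_positive_definite M"
    and "trace M = real CARD('m)"
  shows "\<exists>a :: 'm \<Rightarrow> real^'k. (\<forall>j. norm (a j) = 1) \<and>
           matrix_with_columns a ** transpose (matrix_with_columns a) = M"
proof -
  have adj: "x \<bullet> (M *v y) = (M *v x) \<bullet> y" for x y
    using assms(2) dot_lmul_matrix[of x M y]
    by (metis symmetric_positive_definite_def transpose_matrix_vector)
  have psd: "0 \<le> x \<bullet> (M *v x)" for x
    using assms(2) by (cases "x = 0") (auto simp: symmetric_positive_definite_def less_imp_le)
  obtain b :: "'m \<Rightarrow> real^'k" where b: "\<And>x. M *v x = (\<Sum>j\<in>UNIV. (b j \<bullet> x) *\<^sub>R b j)"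
    using psd_is_frame_operator[where 'm = 'm, OF matrix_vector_mul_linear[of M] adj psd] assms(1)
    by auto
  then have "matrix_with_columns b ** transpose (matrix_with_columns b) = M"
    by (simp add: matrix_eq frame_operator_of_columns)
  then have "(\<Sum>j\<in>UNIV. (norm (b j))\<^sup>2) = real CARD('m)"
    using assms(3) trace_of_columns[of b] by simp
  from unit_norm_rearrangement[OF this] obtain a :: "'m \<Rightarrow> real^'k"
    where a: "\<forall>j. norm (a j) = 1"
      "\<And>x. (\<Sum>j\<in>UNIV. (a j \<bullet> x) *\<^sub>R a j) = (\<Sum>j\<in>UNIV. (b j \<bullet> x) *\<^sub>R b j)"
    by blast
  have "matrix_with_columns a ** transpose (matrix_with_columns a) = M"
    by (simp add: matrix_eq frame_operator_of_columns a(2) b)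
  with a(1) show ?thesis
    by blast
qed

end
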